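(* Assume, in addition to the standing assumptions listed in the context, that: (i) $P$ is a subset of a real vector space satisfying $\lambda p \in P$ for all $p \in P$, $\lambda \in (0,1]$; (ii) $U$ is a subset of $L^\infty_+(Y)$ for some complete measure space $(Y,\Xi,\eta)$, and $\lambda u \in U$ for all $u \in U$, $\lambda \in (0,1]$; (iii) $\lambda S(p,u) \leq S(\lambda p, \lambda u)$ for all $p \in P$, $u \in U$, $\lambda \in (0,1]$, and $S(p,u_1) \leq S(p,u_2)$ for all $u_1,u_2 \in U$ with $u_1 \leq u_2$ and all $p \in P$; (iv) $\lambda \Phi(v) \leq \Phi(\lambda v)$ for all $v \in L^2_+(X)$, $\lambda \in (0,1]$. Let $q \in [1,\infty]$ be an exponent satisfying $S(p,u) \in L^q(X)$ for all $p \in P$ and all $u \in U$. Then, for every $u \in U$ satisfying $u \geq c$ $\eta$-a.e. in $Y$ for some constant $c>0$ and every $v \in U$ satisfying $\|u-v\|_{L^\infty(Y)} \leq c - \rho$ for some $0 < \rho < c$, the minimal and maximal solutions $m(u), m(v), M(u), M(v)$ of (F) with parameters $u$ and $v$ satisfy \[ \|m(u)-m(v)\|_{L^q(X)} \leq \frac{1}{\rho}\,\|m(u)\|_{L^q(X)}\,\|u-v\|_{L^\infty(Y)} \] and \[ \|M(u)-M(v)\|_{L^q(X)} \leq \frac{1}{\rho}\,\|M(u)\|_{L^q(X)}\,\|u-v\|_{L^\infty(Y)}. \]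
   Context: Standing assumptions and notation. $(X,\Sigma,\mu)$ is a complete measure space. $L^q(X)$, $1\le q\le\infty$, are the usual Lebesgue spaces, ordered by $v_1 \leq v_2 :\iff v_1 \leq v_2$ $\mu$-a.e. in $X$, and $L^q_+(X) := \{v \in L^q(X) \mid v \geq 0\}$. The same conventions are used for $(Y,\Xi,\eta)$. $\bar P$ is a set equipped with a partial order $\leq$, having at least two elements and a largest element $\bar p$; $P := \bar P \setminus \{\bar p\}$. $U$ is a nonempty set. $S\colon \bar P \times U \to L^2_+(X)$ satisfies $S(p_1,u) \leq S(p_2,u)$ for all $u \in U$ and $p_1,p_2 \in \bar P$ with $p_1 \leq p_2$. $\Phi\colon L^2(X) \to P$ satisfies $\Phi(v_1) \leq \Phi(v_2)$ for all $v_1,v_2 \in L^2(X)$ with $v_1 \leq v_2$. For $u \in U$, problem (F) with parameter $u$ is: find $y \in L^2(X)$ with $y = S(\Phi(y),u)$. Under the standing assumptions, for every $u \in U$ the solution set of (F) is nonempty and possesses a unique smallest element $m(u)$ and a unique largest element $M(u)$ (the minimal and the maximal solution). *)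

theory Defs
  imports "HOL-Probability.Essential_Supremum"
begin

text \<open>Elements of Lebesgue spaces are genuine equivalence classes, modulo equality almost
  everywhere, of real-valued measurable functions; a class is represented as a set of functions.
  Since the a.e. quantifier only sees \<open>space M\<close>, values outside \<open>space M\<close> are irrelevant.\<close>

type_synonym 'a fclass = "('a \<Rightarrow> real) set"

definition ae_rel :: "'a measure \<Rightarrow> (('a \<Rightarrow> real) \<times> ('a \<Rightarrow> real)) set" where
  "ae_rel M = {(f, g). f \<in> borel_measurable M \<and> g \<in> borel_measurable M \<and> (AE x in M. f x = g x)}"

definition cls :: "'a measure \<Rightarrow> ('a \<Rightarrow> real) \<Rightarrow> 'a fclass" where
  "cls M f = ae_rel M `` {f}"

definition rep :: "'a fclass \<Rightarrow> 'a \<Rightarrow> real" where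
  "rep V = (SOME f. f \<in> V)"

definition L0 :: "'a measure \<Rightarrow> 'a fclass set" where
  "L0 M = borel_measurable M // ae_rel M"

definition fclass_le :: "'a measure \<Rightarrow> 'a fclass \<Rightarrow> 'a fclass \<Rightarrow> bool" where
  "fclass_le M V W \<longleftrightarrow> (AE x in M. rep V x \<le> rep W x)"

definition fclass_scale :: "'a measure \<Rightarrow> real \<Rightarrow> 'a fclass \<Rightarrow> 'a fclass" where
  "fclass_scale M r V = cls M (\<lambda>x. r * rep V x)"

definition fclass_diff :: "'a measure \<Rightarrow> 'a fclass \<Rightarrow> 'a fclass \<Rightarrow> 'a fclass" where
  "fclass_diff M V W = cls M (\<lambda>x. rep V x - rep W x)"

text \<open>Exponents range over \<open>ennreal\<close>, with \<open>\<infinity>\<close> for the essential supremum. The latter is taken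
  in \<open>ennreal\<close>, so that it is \<open>0\<close> (and not \<open>-\<infinity>\<close>) on a space of measure zero.\<close>

definition fun_in_Lq :: "'a measure \<Rightarrow> ennreal \<Rightarrow> ('a \<Rightarrow> real) \<Rightarrow> bool" where
  "fun_in_Lq M q f \<longleftrightarrow> f \<in> borel_measurable M \<and>
     (if q = \<infinity> then esssup M (\<lambda>x. ennreal \<bar>f x\<bar>) < \<infinity>
      else integrable M (\<lambda>x. \<bar>f x\<bar> powr enn2real q))"

definition fun_Lq_norm :: "'a measure \<Rightarrow> ennreal \<Rightarrow> ('a \<Rightarrow> real) \<Rightarrow> real" where
  "fun_Lq_norm M q f =
     (if q = \<infinity> then enn2real (esssup M (\<lambda>x. ennreal \<bar>f x\<bar>))
      else (\<integral>x. \<bar>f x\<bar> powr enn2real q \<partial>M) powr (1 / enn2real q))"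

definition Lq :: "'a measure \<Rightarrow> ennreal \<Rightarrow> 'a fclass set" where
  "Lq M q = {V \<in> L0 M. fun_in_Lq M q (rep V)}"

definition Lq_norm :: "'a measure \<Rightarrow> ennreal \<Rightarrow> 'a fclass \<Rightarrow> real" where
  "Lq_norm M q V = fun_Lq_norm M q (rep V)"

definition Lq_plus :: "'a measure \<Rightarrow> ennreal \<Rightarrow> 'a fclass set" where
  "Lq_plus M q = {V \<in> Lq M q. fclass_le M (cls M (\<lambda>_. 0)) V}"

text \<open>The definitions above do not depend on the choice of representatives.\<close>

lemma equiv_ae_rel: "equiv (borel_measurable M) (ae_rel M)"
proof (rule equivI)
  show "ae_rel M \<subseteq> borel_measurable M \<times> borel_measurable M"
    by (auto simp: ae_rel_def)
  show "refl_on (borel_measurable M) (ae_rel M)"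
    by (auto simp: refl_on_def ae_rel_def)
  show "sym (ae_rel M)"
    by (auto simp: sym_def ae_rel_def eq_commute)
  show "trans (ae_rel M)"
  proof (rule transI)
    fix f g h assume "(f, g) \<in> ae_rel M" "(g, h) \<in> ae_rel M"
    then show "(f, h) \<in> ae_rel M"
      unfolding ae_rel_def by (auto elim: eventually_elim2)
  qed
qed

lemma cls_in_L0: "f \<in> borel_measurable M \<Longrightarrow> cls M f \<in> L0 M"
  by (simp add: cls_def L0_def quotientI)

lemma rep_cls:
  assumes "f \<in> borel_measurable M"
  shows "rep (cls M f) \<in> borel_measurable M" "AE x in M. rep (cls M f) x = f x"
proof -
  have "f \<in> cls M f"
    using assms by (simp add: cls_def ae_rel_def)
  then have "rep (cls M f) \<in> cls M f"
    unfolding rep_def by (metis someI)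
  then show "rep (cls M f) \<in> borel_measurable M" "AE x in M. rep (cls M f) x = f x"
    by (auto simp: cls_def ae_rel_def eq_commute)
qed

lemma cls_eq_iff:
  "f \<in> borel_measurable M \<Longrightarrow> g \<in> borel_measurable M \<Longrightarrow>
   cls M f = cls M g \<longleftrightarrow> (AE x in M. f x = g x)"
  using eq_equiv_class_iff[OF equiv_ae_rel, of f M g] by (simp add: cls_def ae_rel_def)

lemma cls_rep:
  assumes "V \<in> L0 M"
  shows "rep V \<in> borel_measurable M" "cls M (rep V) = V"
proof -
  obtain f where f: "f \<in> borel_measurable M" "V = cls M f"
    using assms by (auto simp: L0_def cls_def elim: quotientE)
  show "rep V \<in> borel_measurable M"
    using rep_cls(1)[OF f(1)] f(2) by simp
  show "cls M (rep V) = V"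
    using rep_cls[OF f(1)] f by (simp add: cls_eq_iff)
qed

lemma fclass_le_cls:
  assumes "f \<in> borel_measurable M" "g \<in> borel_measurable M"
  shows "fclass_le M (cls M f) (cls M g) \<longleftrightarrow> (AE x in M. f x \<le> g x)"
proof -
  have "AE x in M. (rep (cls M f) x \<le> rep (cls M g) x) = (f x \<le> g x)"
    using rep_cls(2)[OF assms(1)] rep_cls(2)[OF assms(2)] by eventually_elim simp
  then show ?thesis
    unfolding fclass_le_def by (rule eventually_subst)
qed

lemma fclass_scale_cls:
  assumes "f \<in> borel_measurable M"
  shows "fclass_scale M r (cls M f) = cls M (\<lambda>x. r * f x)"
proof -
  have "AE x in M. r * rep (cls M f) x = r * f x"
    using rep_cls(2)[OF assms] by eventually_elim simp
  then show ?thesis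
    using assms rep_cls(1)[OF assms] by (simp add: fclass_scale_def cls_eq_iff)
qed

lemma fclass_diff_cls:
  assumes "f \<in> borel_measurable M" "g \<in> borel_measurable M"
  shows "fclass_diff M (cls M f) (cls M g) = cls M (\<lambda>x. f x - g x)"
proof -
  have "AE x in M. rep (cls M f) x - rep (cls M g) x = f x - g x"
    using rep_cls(2)[OF assms(1)] rep_cls(2)[OF assms(2)] by eventually_elim simp
  then show ?thesis
    using assms rep_cls(1)[OF assms(1)] rep_cls(1)[OF assms(2)]
    by (simp add: fclass_diff_def cls_eq_iff)
qed

lemma fun_Lq_cong:
  assumes f: "f \<in> borel_measurable M" and g: "g \<in> borel_measurable M"
    and eq: "AE x in M. f x = g x"
  shows "fun_in_Lq M q f \<longleftrightarrow> fun_in_Lq M q g" "fun_Lq_norm M q f = fun_Lq_norm M q g"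
proof -
  have 1: "esssup M (\<lambda>x. ennreal \<bar>f x\<bar>) = esssup M (\<lambda>x. ennreal \<bar>g x\<bar>)"
  proof -
    have "AE x in M. (ennreal \<bar>f x\<bar> \<le> z) = (ennreal \<bar>g x\<bar> \<le> z)" for z
      using eq by eventually_elim simp
    then have "(AE x in M. ennreal \<bar>f x\<bar> \<le> z) \<longleftrightarrow> (AE x in M. ennreal \<bar>g x\<bar> \<le> z)" for z
      by (rule eventually_subst)
    then show ?thesis
      using f g by (simp add: esssup_eq_AE)
  qed
  have ae: "AE x in M. \<bar>f x\<bar> powr enn2real q = \<bar>g x\<bar> powr enn2real q"
    using eq by eventually_elim simp
  have 2: "integrable M (\<lambda>x. \<bar>f x\<bar> powr enn2real q) \<longleftrightarrow>
           integrable M (\<lambda>x. \<bar>g x\<bar> powr enn2real q)"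
    using f g ae by (intro integrable_cong_AE) auto
  have 3: "(\<integral>x. \<bar>f x\<bar> powr enn2real q \<partial>M) = (\<integral>x. \<bar>g x\<bar> powr enn2real q \<partial>M)"
    using f g ae by (intro integral_cong_AE) auto
  show "fun_in_Lq M q f \<longleftrightarrow> fun_in_Lq M q g"
    using f g 1 2 by (simp add: fun_in_Lq_def)
  show "fun_Lq_norm M q f = fun_Lq_norm M q g"
    using 1 3 by (simp add: fun_Lq_norm_def)
qed

lemma Lq_cls:
  assumes "f \<in> borel_measurable M"
  shows "cls M f \<in> Lq M q \<longleftrightarrow> fun_in_Lq M q f" "Lq_norm M q (cls M f) = fun_Lq_norm M q f"
  using fun_Lq_cong[OF rep_cls(1)[OF assms] assms rep_cls(2)[OF assms]] cls_in_L0[OF assms]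
  by (simp_all add: Lq_def Lq_norm_def)

definition sols :: "'x measure \<Rightarrow> ('p \<Rightarrow> 'u \<Rightarrow> 'x fclass) \<Rightarrow> ('x fclass \<Rightarrow> 'p) \<Rightarrow> 'u \<Rightarrow> 'x fclass set" where
  "sols X S \<Phi> u = {y \<in> Lq X 2. y = S (\<Phi> y) u}"

definition min_sol :: "'x measure \<Rightarrow> ('p \<Rightarrow> 'u \<Rightarrow> 'x fclass) \<Rightarrow> ('x fclass \<Rightarrow> 'p) \<Rightarrow> 'u \<Rightarrow> 'x fclass" where
  "min_sol X S \<Phi> u =
     (THE m. m \<in> sols X S \<Phi> u \<and> (\<forall>y\<in>sols X S \<Phi> u. fclass_le X m y))"

definition max_sol :: "'x measure \<Rightarrow> ('p \<Rightarrow> 'u \<Rightarrow> 'x fclass) \<Rightarrow> ('x fclass \<Rightarrow> 'p) \<Rightarrow> 'u \<Rightarrow> 'x fclass" where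
  "max_sol X S \<Phi> u =
     (THE m. m \<in> sols X S \<Phi> u \<and> (\<forall>y\<in>sols X S \<Phi> u. fclass_le X y m))"

text \<open>The poset \<open>P_bar\<close> is modelled by a type of class \<open>order_top\<close>, so its largest element is
  \<open>top\<close> and \<open>P = - {top}\<close>. An injection \<open>\<iota>\<close> of \<open>P\<close> identifies it with a subset of a real vector
  space; \<open>top\<close> need not lie in that space, and the order need not be related to it.
  The following is the element \<open>r p\<close> of \<open>P\<close>, provided that \<open>r *\<^sub>R \<iota> p \<in> \<iota> ` P\<close>.\<close>

definition pscale :: "('p::order_top \<Rightarrow> 'v::real_vector) \<Rightarrow> real \<Rightarrow> 'p \<Rightarrow> 'p" where
  "pscale \<iota> r p = inv_into (- {top}) \<iota> (r *\<^sub>R \<iota> p)"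

end

theory Submission
  imports Defs
begin

text \<open>
  A solution of the fixed-point problem with parameter \<open>u\<close> is a fixed point of the increasing map
  \<open>T\<^sub>u y = S (\<Phi> y) u\<close> on \<open>L\<^sup>2\<close>. The theorem compares the extremal fixed points of \<open>T\<^sub>u\<close> and \<open>T\<^sub>v\<close> in the
  order, and only at the very end passes to norms.

  Two facts carry the comparison. Firstly, the minimal solution \<open>m u\<close> lies below every supersolution
  (\<open>T\<^sub>u y \<le> y\<close>) and the maximal solution \<open>M u\<close> lies above every subsolution (\<open>y \<le> T\<^sub>u y\<close>); this is the
  Knaster--Tarski theorem in the order interval \<open>[0, S top u]\<close> of \<open>L\<^sup>2\<close>, which is a complete lattice
  (\<open>L2_interval_supremum\<close>, \<open>L2_extremal_fixed_points\<close>). Secondly, if \<open>r u \<le> v\<close> with \<open>0 < r \<le> 1\<close>, then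
  the scaling hypotheses give \<open>r T\<^sub>u y \<le> T\<^sub>v (r y)\<close> for \<open>y \<ge> 0\<close>. Applied to \<open>y = m v / r\<close> this says that
  \<open>m v / r\<close> is a supersolution for \<open>u\<close>, and applied to \<open>y = M u\<close> that \<open>r M u\<close> is a subsolution for
  \<open>v\<close>. Hence \<open>r m u \<le> m v\<close> and \<open>r M u \<le> M v\<close> (\<open>extremal_sols_scale_le\<close>).

  Let \<open>\<delta>\<close> be the distance of \<open>u\<close> and \<open>v\<close> in \<open>L\<^sup>\<infinity>\<close> and put \<open>k = \<delta> / c < 1\<close>. Because \<open>u \<ge> c\<close>,
  one has \<open>\<delta> \<le> k u\<close>, and so \<open>(1 - k) u \<le> v \<le> (1 + k) u\<close>. The comparison, used once from \<open>u\<close> to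
  \<open>v\<close> with the factor \<open>1 - k\<close> and once from \<open>v\<close> to \<open>u\<close> with the factor \<open>1 / (1 + k)\<close>, transfers both
  inequalities to the solutions: \<open>(1 - k) m u \<le> m v \<le> (1 + k) m u\<close>, that is,
  \<open>\<bar>m u - m v\<bar> \<le> k m u\<close> a.e. Taking \<open>L\<^sup>q\<close> norms gives the bound with the factor \<open>1 / c \<le> 1 / \<rho>\<close>.
  The same computation applies to \<open>M\<close>.
\<close>

section \<open>Order, scaling and domination in \<open>L\<^sup>q\<close>\<close>

lemma fun_Lq_dominated:
  assumes f: "f \<in> borel_measurable M" and g: "fun_in_Lq M q g"
    and le: "AE x in M. \<bar>f x\<bar> \<le> k * \<bar>g x\<bar>" and k: "0 \<le> k" and q: "1 \<le> q"
  shows "fun_in_Lq M q f" "fun_Lq_norm M q f \<le> k * fun_Lq_norm M q g"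
proof -
  have gm: "g \<in> borel_measurable M" using g by (simp add: fun_in_Lq_def)
  note [measurable] = f gm
  have "fun_in_Lq M q f \<and> fun_Lq_norm M q f \<le> k * fun_Lq_norm M q g"
  proof (cases "q = \<infinity>")
    case True
    define G where "G = esssup M (\<lambda>x. ennreal \<bar>g x\<bar>)"
    have G: "G < \<infinity>" using g True by (simp add: fun_in_Lq_def G_def)
    have "AE x in M. ennreal \<bar>g x\<bar> \<le> G" unfolding G_def by (rule esssup_AE)
    with le have "AE x in M. ennreal \<bar>f x\<bar> \<le> ennreal k * G"
    proof eventually_elim
      case (elim x)
      have "ennreal \<bar>f x\<bar> \<le> ennreal (k * \<bar>g x\<bar>)" using elim by (intro ennreal_leI)
      also have "\<dots> = ennreal k * ennreal \<bar>g x\<bar>" using k by (simp add: ennreal_mult)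
      also have "\<dots> \<le> ennreal k * G" using elim by (intro mult_left_mono) auto
      finally show ?case .
    qed
    then have *: "esssup M (\<lambda>x. ennreal \<bar>f x\<bar>) \<le> ennreal k * G"
      by (intro esssup_I) auto
    have fin: "ennreal k * G < \<infinity>" using G by (simp add: ennreal_mult_less_top)
    have "enn2real (esssup M (\<lambda>x. ennreal \<bar>f x\<bar>)) \<le> enn2real (ennreal k * G)"
      using * fin by (intro enn2real_mono) auto
    then show ?thesis
      using * fin True k by (simp add: fun_in_Lq_def fun_Lq_norm_def G_def[symmetric] enn2real_mult)
  next
    case False
    define p where "p = enn2real q"
    have p: "1 \<le> p"
      using q False unfolding p_def
      by (metis enn2real_1 enn2real_mono infinity_ennreal_def less_top)
    have ig: "integrable M (\<lambda>x. \<bar>g x\<bar> powr p)"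
      using g False by (simp add: fun_in_Lq_def p_def)
    have ae: "AE x in M. \<bar>f x\<bar> powr p \<le> k powr p * \<bar>g x\<bar> powr p"
      using le
    proof eventually_elim
      case (elim x)
      then have "\<bar>f x\<bar> powr p \<le> (k * \<bar>g x\<bar>) powr p" using p by (intro powr_mono2) auto
      then show ?case using k by (simp add: powr_mult)
    qed
    have if': "integrable M (\<lambda>x. \<bar>f x\<bar> powr p)"
      by (rule Bochner_Integration.integrable_bound[where f="\<lambda>x. k powr p * \<bar>g x\<bar> powr p"])
        (use ig ae in auto)
    have "(\<integral>x. \<bar>f x\<bar> powr p \<partial>M) \<le> (\<integral>x. k powr p * \<bar>g x\<bar> powr p \<partial>M)"
      using if' ig ae by (intro integral_mono_AE) auto
    then have "(\<integral>x. \<bar>f x\<bar> powr p \<partial>M) powr (1/p) \<le> (k powr p * (\<integral>x. \<bar>g x\<bar> powr p \<partial>M)) powr (1/p)"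
      using p by (intro powr_mono2) auto
    also have "\<dots> = k * (\<integral>x. \<bar>g x\<bar> powr p \<partial>M) powr (1/p)"
      using p k by (simp add: powr_mult powr_powr)
    finally show ?thesis
      using False if' f by (simp add: fun_in_Lq_def fun_Lq_norm_def p_def)
  qed
  then show "fun_in_Lq M q f" "fun_Lq_norm M q f \<le> k * fun_Lq_norm M q g" by auto
qed

lemma Lq_dominated:
  assumes V: "V \<in> L0 M" and W: "W \<in> Lq M q"
    and le: "AE x in M. \<bar>rep V x\<bar> \<le> k * \<bar>rep W x\<bar>" and k: "0 \<le> k" and q: "1 \<le> q"
  shows "V \<in> Lq M q" "Lq_norm M q V \<le> k * Lq_norm M q W"
  using fun_Lq_dominated[OF cls_rep(1)[OF V] _ le k q] V W by (auto simp: Lq_def Lq_norm_def)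

lemma fclass_le_refl: "fclass_le M V V"
  by (simp add: fclass_le_def)

lemma fclass_le_trans: "fclass_le M V W \<Longrightarrow> fclass_le M W Z \<Longrightarrow> fclass_le M V Z"
  unfolding fclass_le_def by (auto elim: eventually_elim2)

lemma fclass_le_antisym:
  assumes "V \<in> L0 M" "W \<in> L0 M" "fclass_le M V W" "fclass_le M W V"
  shows "V = W"
proof -
  have "AE x in M. rep V x = rep W x"
    using assms(3,4) unfolding fclass_le_def by eventually_elim auto
  then have "cls M (rep V) = cls M (rep W)"
    using assms cls_rep(1) by (subst cls_eq_iff) auto
  then show ?thesis using cls_rep(2) assms by metis
qed

lemma fclass_nonneg_iff: "fclass_le M (cls M (\<lambda>_. 0)) V \<longleftrightarrow> (AE x in M. 0 \<le> rep V x)"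
proof -
  have "AE x in M. (rep (cls M (\<lambda>_. 0)) x \<le> rep V x) = (0 \<le> rep V x)"
    using rep_cls(2)[of "\<lambda>_. 0" M] by auto
  then show ?thesis unfolding fclass_le_def by (rule eventually_subst)
qed

lemma Lq_plus_iff: "V \<in> Lq_plus M q \<longleftrightarrow> V \<in> Lq M q \<and> (AE x in M. 0 \<le> rep V x)"
  by (simp add: Lq_plus_def fclass_nonneg_iff)

lemma Lq_L0: "V \<in> Lq M q \<Longrightarrow> V \<in> L0 M"
  by (simp add: Lq_def)

lemma rep_fclass_scale:
  assumes "V \<in> L0 M"
  shows "fclass_scale M r V \<in> L0 M" "AE x in M. rep (fclass_scale M r V) x = r * rep V x"
  using cls_rep(1)[OF assms] unfolding fclass_scale_def
  by (auto intro!: cls_in_L0 rep_cls(2))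

lemma rep_fclass_diff:
  assumes "V \<in> L0 M" "W \<in> L0 M"
  shows "fclass_diff M V W \<in> L0 M" "AE x in M. rep (fclass_diff M V W) x = rep V x - rep W x"
  using cls_rep(1)[OF assms(1)] cls_rep(1)[OF assms(2)] unfolding fclass_diff_def
  by (auto intro!: cls_in_L0 rep_cls(2))

lemma Lq_plus_scale:
  assumes "V \<in> Lq_plus M q" "0 \<le> r" "1 \<le> q"
  shows "fclass_scale M r V \<in> Lq_plus M q"
proof -
  have V: "V \<in> Lq M q" "V \<in> L0 M" "AE x in M. 0 \<le> rep V x"
    using assms by (auto simp: Lq_plus_iff Lq_def)
  note s = rep_fclass_scale[OF V(2), of r]
  have "AE x in M. \<bar>rep (fclass_scale M r V) x\<bar> \<le> r * \<bar>rep V x\<bar>"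
    using s(2) by eventually_elim (use assms in \<open>auto simp: abs_mult\<close>)
  then have "fclass_scale M r V \<in> Lq M q" using Lq_dominated(1) s(1) V(1) assms by blast
  moreover have "AE x in M. 0 \<le> rep (fclass_scale M r V) x"
    using s(2) V(3) by eventually_elim (use assms in auto)
  ultimately show ?thesis by (simp add: Lq_plus_iff)
qed

lemma Lq_plus_solid:
  assumes "V \<in> L0 M" "AE x in M. 0 \<le> rep V x" "fclass_le M V W" "W \<in> Lq M q" "1 \<le> q"
  shows "V \<in> Lq_plus M q"
proof -
  have "AE x in M. \<bar>rep V x\<bar> \<le> 1 * \<bar>rep W x\<bar>"
    using assms(2,3) unfolding fclass_le_def by eventually_elim auto
  then show ?thesis using Lq_dominated(1)[OF assms(1,4), of 1] assms by (simp add: Lq_plus_iff)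
qed

section \<open>Suprema in order intervals of \<open>L\<^sup>2\<close>\<close>

text \<open>An uncountable pointwise supremum can be non-measurable and can be far too large a.e. The remedy
  is to maximise the integral of the supremum over countable subfamilies: the maximum is attained,
  since a union of countably many maximising subfamilies is again countable, and enlarging a
  maximiser by one more member cannot raise its finite integral, hence changes nothing a.e.
  The integrable bound \<open>W\<close> replaces \<open>\<sigma>\<close>-finiteness of the measure.\<close>

lemma countable_subfamily_dominating:
  fixes F :: "'i \<Rightarrow> 'a \<Rightarrow> ennreal"
  assumes ne: "A \<noteq> {}"
    and meas [measurable]: "\<And>i. i \<in> A \<Longrightarrow> F i \<in> borel_measurable M"
    and bound: "\<And>i. i \<in> A \<Longrightarrow> AE x in M. F i x \<le> W x"
    and fin: "(\<integral>\<^sup>+x. W x \<partial>M) < \<infinity>"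
  obtains B where "B \<subseteq> A" "countable B" "B \<noteq> {}"
    "\<And>i. i \<in> A \<Longrightarrow> AE x in M. F i x \<le> (SUP j\<in>B. F j x)"
proof -
  define J where "J B = (\<integral>\<^sup>+x. (SUP j\<in>B. F j x) \<partial>M)" for B
  define K where "K = {B. B \<subseteq> A \<and> countable B \<and> B \<noteq> {}}"
  obtain a where a: "a \<in> A" using ne by auto
  have "{a} \<in> K" using a by (auto simp: K_def)
  then have "K \<noteq> {}" by auto
  then obtain f :: "nat \<Rightarrow> ennreal" where f: "range f \<subseteq> J ` K" "Sup (J ` K) = Sup (range f)"
    using ennreal_Sup_countable_SUP[of "J ` K"] by auto
  have "\<forall>n. \<exists>B. B \<in> K \<and> f n = J B" using f(1) by auto
  then obtain Bs where Bs: "\<And>n. Bs n \<in> K" "\<And>n. f n = J (Bs n)" by metis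
  define B where "B = (\<Union>n. Bs n)"
  have BK: "B \<in> K" using Bs(1) by (fastforce simp: B_def K_def)
  have "f n \<le> J B" for n
    unfolding Bs(2) J_def B_def by (intro nn_integral_mono SUP_subset_mono) auto
  then have max: "J C \<le> J B" if "C \<in> K" for C
  proof -
    have "J C \<le> Sup (range f)" using that f(2) by (metis SUP_upper)
    also have "\<dots> \<le> J B" using \<open>\<And>n. f n \<le> J B\<close> by (auto intro: SUP_least)
    finally show ?thesis .
  qed
  have B: "B \<subseteq> A" "countable B" "B \<noteq> {}" using BK by (auto simp: K_def)
  have SUP_meas [measurable]: "(\<lambda>x. SUP j\<in>C. F j x) \<in> borel_measurable M" if "C \<in> K" for C
    using that by (intro borel_measurable_SUP) (auto simp: K_def intro!: meas)
  have "AE x in M. \<forall>j\<in>B. F j x \<le> W x"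
    using B bound by (subst AE_ball_countable) auto
  then have "AE x in M. (SUP j\<in>B. F j x) \<le> W x"
    by eventually_elim (auto intro: SUP_least)
  then have "J B \<le> (\<integral>\<^sup>+x. W x \<partial>M)" unfolding J_def by (rule nn_integral_mono_AE)
  then have JB: "J B \<noteq> \<infinity>" using fin by auto
  have "AE x in M. F i x \<le> (SUP j\<in>B. F j x)" if i: "i \<in> A" for i
  proof -
    \<comment> \<open>Adding \<open>i\<close> to the maximiser \<open>B\<close> leaves the integral unchanged.\<close>
    have C: "insert i B \<in> K" using i B by (auto simp: K_def)
    let ?g = "\<lambda>x. SUP j\<in>B. F j x" and ?h = "\<lambda>x. SUP j\<in>insert i B. F j x"
    have le: "?g x \<le> ?h x" for x by (rule SUP_subset_mono) auto
    have "(\<integral>\<^sup>+x. ?h x - ?g x \<partial>M) = J (insert i B) - J B"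
      unfolding J_def using JB le SUP_meas[OF C] SUP_meas[OF BK]
      by (intro nn_integral_diff) (auto simp: J_def)
    also have "\<dots> = 0" using max[OF C] JB by (intro diff_eq_0_ennreal) (auto simp: less_top)
    finally have "AE x in M. ?h x - ?g x = 0"
      using SUP_meas[OF C] SUP_meas[OF BK]
      by (subst (asm) nn_integral_0_iff_AE) auto
    then show ?thesis
    proof eventually_elim
      case (elim x)
      then have "?h x \<le> ?g x" by (simp add: diff_eq_0_iff_ennreal)
      moreover have "F i x \<le> ?h x" by (rule SUP_upper) auto
      ultimately show ?case by order
    qed
  qed
  with B show ?thesis using that by blast
qed

text \<open>The integrability of \<open>W\<^sup>2\<close> makes the squares of the members of \<open>A\<close> a family to which the
  countable reduction applies; since all members are nonnegative, squaring and taking roots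
  preserve the order. The supremum is least because it is built from countably many members, so
  that the exceptional null sets of an upper bound can be united.\<close>

lemma L2_interval_supremum:
  assumes W: "W \<in> Lq M 2" and ne: "A \<noteq> {}"
    and A: "A \<subseteq> {V \<in> Lq_plus M 2. fclass_le M V W}"
  obtains G where "G \<in> Lq_plus M 2" "\<And>V. V \<in> A \<Longrightarrow> fclass_le M V G"
    "\<And>H. (\<And>V. V \<in> A \<Longrightarrow> fclass_le M V H) \<Longrightarrow> fclass_le M G H"
proof -
  define F where "F V x = ennreal ((rep V x)\<^sup>2)" for V :: "'a fclass" and x
  have meas: "rep V \<in> borel_measurable M" if "V \<in> A" for V
    using that A by (intro cls_rep(1)) (auto simp: Lq_plus_iff Lq_L0)
  have pos: "AE x in M. 0 \<le> rep V x" if "V \<in> A" for V using that A by (auto simp: Lq_plus_iff)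
  have Fm: "F V \<in> borel_measurable M" if "V \<in> A" for V
    unfolding F_def using meas[OF that] by measurable
  have "integrable M (\<lambda>x. \<bar>rep W x\<bar> powr 2)" using W by (simp add: Lq_def fun_in_Lq_def)
  then have "integrable M (\<lambda>x. (rep W x)\<^sup>2)" by (simp add: powr_numeral)
  then have fin: "(\<integral>\<^sup>+x. F W x \<partial>M) < \<infinity>"
    unfolding F_def by (subst nn_integral_eq_integral) auto
  have bound: "AE x in M. F V x \<le> F W x" if "V \<in> A" for V
  proof -
    have "AE x in M. rep V x \<le> rep W x" using that A by (auto simp: fclass_le_def)
    with pos[OF that] show ?thesis
      by eventually_elim (auto simp: F_def intro!: ennreal_leI power_mono)
  qed
  obtain B where B: "B \<subseteq> A" "countable B" "B \<noteq> {}"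
    and dom: "\<And>V. V \<in> A \<Longrightarrow> AE x in M. F V x \<le> (SUP j\<in>B. F j x)"
    by (rule countable_subfamily_dominating[OF ne Fm bound fin]) (assumption | rule that)+
  define g where "g x = sqrt (enn2real (SUP j\<in>B. F j x))" for x
  have "(\<lambda>x. SUP j\<in>B. F j x) \<in> borel_measurable M"
    using B Fm by (intro borel_measurable_SUP) auto
  then have gm: "g \<in> borel_measurable M" unfolding g_def by measurable
  have g_le: "AE x in M. g x \<le> rep H x" if H: "\<And>V. V \<in> A \<Longrightarrow> fclass_le M V H" for H
  proof -
    have "AE x in M. \<forall>V\<in>B. 0 \<le> rep V x \<and> rep V x \<le> rep H x"
      using B pos H by (subst AE_ball_countable) (auto simp: fclass_le_def)
    then show ?thesis
    proof eventually_elim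
      case (elim x)
      then have "0 \<le> rep H x" using B(3) by force
      have "(SUP j\<in>B. F j x) \<le> ennreal ((rep H x)\<^sup>2)"
        using elim by (intro SUP_least) (auto simp: F_def intro!: ennreal_leI power_mono)
      then have "enn2real (SUP j\<in>B. F j x) \<le> (rep H x)\<^sup>2"
        by (intro enn2real_leI) auto
      then show ?case
        unfolding g_def using \<open>0 \<le> rep H x\<close> by (simp add: real_le_lsqrt)
    qed
  qed
  define G where "G = cls M g"
  have G: "G \<in> L0 M" "AE x in M. rep G x = g x"
    unfolding G_def using gm by (auto intro: cls_in_L0 rep_cls(2))
  have least: "fclass_le M G H" if H: "\<And>V. V \<in> A \<Longrightarrow> fclass_le M V H" for H
  proof -
    have "AE x in M. g x \<le> rep H x" using H by (rule g_le)
    then show ?thesis unfolding fclass_le_def using G(2) by eventually_elim auto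
  qed
  have upper: "fclass_le M V G" if V: "V \<in> A" for V
  proof -
    have "AE x in M. \<forall>j\<in>B. F j x \<le> F W x"
      using B bound by (subst AE_ball_countable) auto
    with G(2) dom[OF V] have "AE x in M. rep V x \<le> rep G x"
    proof eventually_elim
      case (elim x)
      have "(SUP j\<in>B. F j x) \<le> F W x" using elim by (intro SUP_least) auto
      then have "(SUP j\<in>B. F j x) < \<infinity>" by (simp add: F_def le_less_trans)
      then have "(rep V x)\<^sup>2 \<le> enn2real (SUP j\<in>B. F j x)"
        using elim(2) unfolding F_def by (metis enn2real_ennreal enn2real_mono infinity_ennreal_def zero_le_power2)
      then have "rep V x \<le> g x" unfolding g_def by (rule real_le_rsqrt)
      then show ?case using elim by simp
    qed
    then show ?thesis by (simp add: fclass_le_def)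
  qed
  have "AE x in M. 0 \<le> rep G x" using G(2) by eventually_elim (simp add: g_def)
  moreover have "fclass_le M G W" using A by (intro least) auto
  ultimately have "G \<in> Lq_plus M 2" using Lq_plus_solid G(1) W by (metis one_le_numeral)
  with upper least show ?thesis using that by blast
qed

section \<open>Extremal fixed points\<close>

text \<open>The set \<open>C\<close> with the relation \<open>le\<close> is a complete lattice given by its least element and suprema
  of nonempty subsets. The least fixed point is obtained from suprema alone, as the supremum of all
  lower bounds of the set of pre-fixed points.\<close>

lemma Knaster_Tarski_on:
  assumes trans: "\<And>x y z. x \<in> C \<Longrightarrow> y \<in> C \<Longrightarrow> z \<in> C \<Longrightarrow> le x y \<Longrightarrow> le y z \<Longrightarrow> le x z"
    and antisym: "\<And>x y. x \<in> C \<Longrightarrow> y \<in> C \<Longrightarrow> le x y \<Longrightarrow> le y x \<Longrightarrow> x = y"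
    and bot: "b \<in> C" "\<And>x. x \<in> C \<Longrightarrow> le b x"
    and sup: "\<And>A. A \<subseteq> C \<Longrightarrow> A \<noteq> {} \<Longrightarrow>
      \<exists>g\<in>C. (\<forall>a\<in>A. le a g) \<and> (\<forall>h\<in>C. (\<forall>a\<in>A. le a h) \<longrightarrow> le g h)"
    and T: "\<And>x. x \<in> C \<Longrightarrow> T x \<in> C"
    and mono: "\<And>x y. x \<in> C \<Longrightarrow> y \<in> C \<Longrightarrow> le x y \<Longrightarrow> le (T x) (T y)"
  shows "\<exists>m\<in>C. T m = m \<and> (\<forall>y\<in>C. le (T y) y \<longrightarrow> le m y)"
    and "\<exists>m\<in>C. T m = m \<and> (\<forall>y\<in>C. le y (T y) \<longrightarrow> le y m)"
proof -
  let ?D = "{y\<in>C. le (T y) y}" and ?E = "{y\<in>C. le y (T y)}"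
  let ?L = "{x\<in>C. \<forall>d\<in>?D. le x d}"
  have "b \<in> ?L" using bot by auto
  then obtain m where m: "m \<in> C" "\<And>a. a \<in> ?L \<Longrightarrow> le a m"
    "\<And>h. h \<in> C \<Longrightarrow> (\<And>a. a \<in> ?L \<Longrightarrow> le a h) \<Longrightarrow> le m h"
    using sup[of ?L] by blast
  have mD: "le m d" if "d \<in> ?D" for d using that by (intro m(3)) auto
  have "le (T m) d" if "d \<in> ?D" for d
    using that m(1) T mono mD[OF that] trans[of "T m" "T d" d] by auto
  then have "T m \<in> ?L" using m(1) T by auto
  then have 1: "le (T m) m" by (rule m(2))
  then have "T m \<in> ?D" using m(1) T mono by auto
  then have "le m (T m)" by (rule mD)
  with 1 have "T m = m" using antisym m(1) T by auto
  with m(1) mD show "\<exists>m\<in>C. T m = m \<and> (\<forall>y\<in>C. le (T y) y \<longrightarrow> le m y)" by auto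
  have "b \<in> ?E" using bot T by auto
  then obtain M where M: "M \<in> C" "\<And>a. a \<in> ?E \<Longrightarrow> le a M"
    "\<And>h. h \<in> C \<Longrightarrow> (\<And>a. a \<in> ?E \<Longrightarrow> le a h) \<Longrightarrow> le M h"
    using sup[of ?E] by blast
  have "le a (T M)" if "a \<in> ?E" for a
    using that M(1) T mono M(2)[OF that] by (auto intro: trans[of a "T a"])
  then have 2: "le M (T M)" using M(1) T by (intro M(3)) auto
  then have "T M \<in> ?E" using M(1) T mono by auto
  then have "le (T M) M" by (rule M(2))
  with 2 have "T M = M" using antisym M(1) T by auto
  with M show "\<exists>m\<in>C. T m = m \<and> (\<forall>y\<in>C. le y (T y) \<longrightarrow> le y m)" by blast
qed

text \<open>The pre-fixed points \<open>y\<close> compared with here need not lie in the interval \<open>[0, W]\<close> on which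
  Knaster--Tarski is applied: \<open>T y\<close> does lie there, is again a pre-fixed point, and
  satisfies \<open>T y \<le> y\<close>. The same step serves post-fixed points.\<close>

lemma L2_extremal_fixed_points:
  assumes W: "W \<in> Lq_plus M 2"
    and T: "\<And>y. y \<in> Lq M 2 \<Longrightarrow> T y \<in> Lq_plus M 2"
    and TW: "\<And>y. y \<in> Lq M 2 \<Longrightarrow> fclass_le M (T y) W"
    and mono: "\<And>y z. y \<in> Lq M 2 \<Longrightarrow> z \<in> Lq M 2 \<Longrightarrow> fclass_le M y z \<Longrightarrow> fclass_le M (T y) (T z)"
  shows "\<exists>m\<in>Lq M 2. T m = m \<and> (\<forall>y\<in>Lq M 2. fclass_le M (T y) y \<longrightarrow> fclass_le M m y)"
    and "\<exists>m\<in>Lq M 2. T m = m \<and> (\<forall>y\<in>Lq M 2. fclass_le M y (T y) \<longrightarrow> fclass_le M y m)"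
proof -
  define C where "C = {V \<in> Lq_plus M 2. fclass_le M V W}"
  define Z where "Z = cls M (\<lambda>_. 0)"
  have C2: "V \<in> Lq M 2" if "V \<in> C" for V using that by (simp add: C_def Lq_plus_def)
  have TC: "T y \<in> C" if "y \<in> Lq M 2" for y using T[OF that] TW[OF that] by (simp add: C_def)
  have "Z \<in> L0 M" unfolding Z_def by (rule cls_in_L0) simp
  moreover have "AE x in M. 0 \<le> rep Z x" using fclass_le_refl[of M Z] unfolding Z_def fclass_nonneg_iff .
  moreover have ZW: "fclass_le M Z W" using W by (simp add: Lq_plus_def Z_def)
  ultimately have "Z \<in> Lq_plus M 2" using W by (intro Lq_plus_solid) (auto simp: Lq_plus_def)
  with ZW have ZC: "Z \<in> C" by (simp add: C_def)
  have Zle: "fclass_le M Z V" if "V \<in> C" for V using that by (simp add: C_def Lq_plus_def Z_def)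
  have sup: "\<exists>g\<in>C. (\<forall>a\<in>A. fclass_le M a g) \<and> (\<forall>h\<in>C. (\<forall>a\<in>A. fclass_le M a h) \<longrightarrow> fclass_le M g h)"
    if A: "A \<subseteq> C" "A \<noteq> {}" for A
  proof -
    obtain G where G: "G \<in> Lq_plus M 2" "\<And>V. V \<in> A \<Longrightarrow> fclass_le M V G"
      "\<And>H. (\<And>V. V \<in> A \<Longrightarrow> fclass_le M V H) \<Longrightarrow> fclass_le M G H"
    proof (rule L2_interval_supremum)
      show "W \<in> Lq M 2" using W by (simp add: Lq_plus_def)
    qed (use A in \<open>auto simp: C_def\<close>)
    have "fclass_le M G W" using A by (intro G(3)) (auto simp: C_def)
    then show ?thesis using G by (intro bexI[of _ G]) (auto simp: C_def)
  qed
  have trans: "fclass_le M x z" if "fclass_le M x y" "fclass_le M y z" for x y z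
    using that by (rule fclass_le_trans)
  have antisym: "x = y" if "x \<in> C" "y \<in> C" "fclass_le M x y" "fclass_le M y x" for x y
    using that fclass_le_antisym[of x M y] Lq_L0[OF C2] by blast
  have TCC: "T x \<in> C" if "x \<in> C" for x using TC[OF C2[OF that]] .
  have monoC: "fclass_le M (T x) (T y)" if "x \<in> C" "y \<in> C" "fclass_le M x y" for x y
    using mono[OF C2[OF that(1)] C2[OF that(2)] that(3)] .
  have KT: "\<exists>m\<in>C. T m = m \<and> (\<forall>y\<in>C. fclass_le M (T y) y \<longrightarrow> fclass_le M m y)"
    "\<exists>m\<in>C. T m = m \<and> (\<forall>y\<in>C. fclass_le M y (T y) \<longrightarrow> fclass_le M y m)"
    by (rule Knaster_Tarski_on[where b = Z], erule (1) trans, erule (3) antisym, rule ZC, erule Zle,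
        erule (1) sup, erule TCC, erule (2) monoC)+
  obtain m where m: "m \<in> C" "T m = m" "\<And>y. y \<in> C \<Longrightarrow> fclass_le M (T y) y \<Longrightarrow> fclass_le M m y"
    using KT(1) by blast
  have "fclass_le M m y" if y: "y \<in> Lq M 2" "fclass_le M (T y) y" for y
  proof -
    have "fclass_le M (T (T y)) (T y)" using mono[OF C2[OF TC[OF y(1)]] y(1) y(2)] .
    then have "fclass_le M m (T y)" by (rule m(3)[OF TC[OF y(1)]])
    then show ?thesis using y(2) by (rule fclass_le_trans)
  qed
  with m C2 show "\<exists>m\<in>Lq M 2. T m = m \<and> (\<forall>y\<in>Lq M 2. fclass_le M (T y) y \<longrightarrow> fclass_le M m y)" by blast
  obtain m where m: "m \<in> C" "T m = m" "\<And>y. y \<in> C \<Longrightarrow> fclass_le M y (T y) \<Longrightarrow> fclass_le M y m"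
    using KT(2) by blast
  have "fclass_le M y m" if y: "y \<in> Lq M 2" "fclass_le M y (T y)" for y
  proof -
    have "fclass_le M (T y) (T (T y))" using mono[OF y(1) C2[OF TC[OF y(1)]] y(2)] .
    then have "fclass_le M (T y) m" by (rule m(3)[OF TC[OF y(1)]])
    with y(2) show ?thesis by (rule fclass_le_trans)
  qed
  with m C2 show "\<exists>m\<in>Lq M 2. T m = m \<and> (\<forall>y\<in>Lq M 2. fclass_le M y (T y) \<longrightarrow> fclass_le M y m)" by blast
qed

section \<open>The parametrised fixed-point problem\<close>

text \<open>
  Monotonicity alone provides the extremal solutions and their comparison with sub- and
  supersolutions; scaling is added in a second step, since it needs the parameters to be function
  classes.
\<close>

locale monotone_problem =
  fixes X :: "'x measure" and S :: "'p::order_top \<Rightarrow> 'u \<Rightarrow> 'x fclass"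
    and \<Phi> :: "'x fclass \<Rightarrow> 'p" and U :: "'u set"
  assumes S_range: "u \<in> U \<Longrightarrow> S p u \<in> Lq_plus X 2"
    and S_mono: "u \<in> U \<Longrightarrow> p1 \<le> p2 \<Longrightarrow> fclass_le X (S p1 u) (S p2 u)"
    and \<Phi>_mono: "v1 \<in> Lq X 2 \<Longrightarrow> v2 \<in> Lq X 2 \<Longrightarrow> fclass_le X v1 v2 \<Longrightarrow> \<Phi> v1 \<le> \<Phi> v2"
begin

lemma min_sol:
  assumes u: "u \<in> U"
  shows "min_sol X S \<Phi> u \<in> sols X S \<Phi> u"
    and "\<And>y. y \<in> Lq X 2 \<Longrightarrow> fclass_le X (S (\<Phi> y) u) y \<Longrightarrow> fclass_le X (min_sol X S \<Phi> u) y"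
proof -
  obtain m where m: "m \<in> Lq X 2" "S (\<Phi> m) u = m"
      "\<And>y. y \<in> Lq X 2 \<Longrightarrow> fclass_le X (S (\<Phi> y) u) y \<Longrightarrow> fclass_le X m y"
    using L2_extremal_fixed_points(1)[where T = "\<lambda>y. S (\<Phi> y) u", OF S_range[OF u] S_range[OF u]
        S_mono[OF u top_greatest] S_mono[OF u \<Phi>_mono]] by auto
  have ms: "m \<in> sols X S \<Phi> u" using m by (simp add: sols_def)
  have least: "fclass_le X m y" if "y \<in> sols X S \<Phi> u" for y
    using that m(3)[of y] fclass_le_refl[of X y] by (simp add: sols_def)
  have "min_sol X S \<Phi> u = m"
    unfolding min_sol_def
  proof (rule the_equality)
    show "m \<in> sols X S \<Phi> u \<and> (\<forall>y\<in>sols X S \<Phi> u. fclass_le X m y)" using ms least by auto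
  next
    fix n assume "n \<in> sols X S \<Phi> u \<and> (\<forall>y\<in>sols X S \<Phi> u. fclass_le X n y)"
    then show "n = m" using ms least fclass_le_antisym[of n X m] Lq_L0[of _ X 2] by (auto simp: sols_def)
  qed
  then show "min_sol X S \<Phi> u \<in> sols X S \<Phi> u"
    "\<And>y. y \<in> Lq X 2 \<Longrightarrow> fclass_le X (S (\<Phi> y) u) y \<Longrightarrow> fclass_le X (min_sol X S \<Phi> u) y"
    using ms m(3) by auto
qed

lemma max_sol:
  assumes u: "u \<in> U"
  shows "max_sol X S \<Phi> u \<in> sols X S \<Phi> u"
    and "\<And>y. y \<in> Lq X 2 \<Longrightarrow> fclass_le X y (S (\<Phi> y) u) \<Longrightarrow> fclass_le X y (max_sol X S \<Phi> u)"
proof -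
  obtain m where m: "m \<in> Lq X 2" "S (\<Phi> m) u = m"
      "\<And>y. y \<in> Lq X 2 \<Longrightarrow> fclass_le X y (S (\<Phi> y) u) \<Longrightarrow> fclass_le X y m"
    using L2_extremal_fixed_points(2)[where T = "\<lambda>y. S (\<Phi> y) u", OF S_range[OF u] S_range[OF u]
        S_mono[OF u top_greatest] S_mono[OF u \<Phi>_mono]] by auto
  have ms: "m \<in> sols X S \<Phi> u" using m by (simp add: sols_def)
  have greatest: "fclass_le X y m" if "y \<in> sols X S \<Phi> u" for y
    using that m(3)[of y] fclass_le_refl[of X y] by (simp add: sols_def)
  have "max_sol X S \<Phi> u = m"
    unfolding max_sol_def
  proof (rule the_equality)
    show "m \<in> sols X S \<Phi> u \<and> (\<forall>y\<in>sols X S \<Phi> u. fclass_le X y m)" using ms greatest by auto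
  next
    fix n assume "n \<in> sols X S \<Phi> u \<and> (\<forall>y\<in>sols X S \<Phi> u. fclass_le X y n)"
    then show "n = m" using ms greatest fclass_le_antisym[of n X m] Lq_L0[of _ X 2] by (auto simp: sols_def)
  qed
  then show "max_sol X S \<Phi> u \<in> sols X S \<Phi> u"
    "\<And>y. y \<in> Lq X 2 \<Longrightarrow> fclass_le X y (S (\<Phi> y) u) \<Longrightarrow> fclass_le X y (max_sol X S \<Phi> u)"
    using ms m(3) by auto
qed

lemma sols_Lq_plus: "u \<in> U \<Longrightarrow> y \<in> sols X S \<Phi> u \<Longrightarrow> y \<in> Lq_plus X 2"
  using S_range[of u "\<Phi> y"] by (simp add: sols_def)

end

locale subhomogeneous_problem = monotone_problem X S \<Phi> U
  for X :: "'x measure" and S :: "'p::order_top \<Rightarrow> 'y fclass \<Rightarrow> 'x fclass"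
    and \<Phi> :: "'x fclass \<Rightarrow> 'p" and U :: "'y fclass set" +
  fixes Y :: "'y measure" and \<iota> :: "'p \<Rightarrow> 'v::real_vector"
  assumes \<Phi>_range: "v \<in> Lq X 2 \<Longrightarrow> \<Phi> v \<in> - {top}"
    and U_scale: "u \<in> U \<Longrightarrow> r \<in> {0<..1} \<Longrightarrow> fclass_scale Y r u \<in> U"
    and S_scale: "p \<in> - {top} \<Longrightarrow> u \<in> U \<Longrightarrow> r \<in> {0<..1} \<Longrightarrow>
        fclass_le X (fclass_scale X r (S p u)) (S (pscale \<iota> r p) (fclass_scale Y r u))"
    and S_mono_U: "p \<in> - {top} \<Longrightarrow> u1 \<in> U \<Longrightarrow> u2 \<in> U \<Longrightarrow> fclass_le Y u1 u2 \<Longrightarrow>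
        fclass_le X (S p u1) (S p u2)"
    and \<Phi>_scale: "v \<in> Lq_plus X 2 \<Longrightarrow> r \<in> {0<..1} \<Longrightarrow>
        pscale \<iota> r (\<Phi> v) \<le> \<Phi> (fclass_scale X r v)"
begin

text \<open>With \<open>T\<^sub>w y = S (\<Phi> y) w\<close> this is \<open>r T\<^sub>u y \<le> T\<^sub>v (r y)\<close>. The factor \<open>r\<close> is first moved inside \<open>S\<close>; then
  \<open>r \<Phi> y\<close> is enlarged to \<open>\<Phi> (r y)\<close>, and finally \<open>r u\<close> to \<open>v\<close>.\<close>

lemma scaled_solution_operator_le:
  assumes y: "y \<in> Lq_plus X 2" and u: "u \<in> U" and v: "v \<in> U" and r: "r \<in> {0<..1}"
    and le: "fclass_le Y (fclass_scale Y r u) v"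
  shows "fclass_le X (fclass_scale X r (S (\<Phi> y) u)) (S (\<Phi> (fclass_scale X r y)) v)"
proof -
  note [trans] = fclass_le_trans
  have y2: "y \<in> Lq X 2" and ry2: "fclass_scale X r y \<in> Lq X 2"
    using y Lq_plus_scale[OF y, of r] r by (auto simp: Lq_plus_def)
  have "fclass_le X (fclass_scale X r (S (\<Phi> y) u)) (S (pscale \<iota> r (\<Phi> y)) (fclass_scale Y r u))"
    using S_scale \<Phi>_range y2 u r by blast
  also have "fclass_le X \<dots> (S (\<Phi> (fclass_scale X r y)) (fclass_scale Y r u))"
    using S_mono U_scale \<Phi>_scale y u r by blast
  also have "fclass_le X \<dots> (S (\<Phi> (fclass_scale X r y)) v)"
    using S_mono_U \<Phi>_range ry2 U_scale u v r le by blast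
  finally show ?thesis .
qed

lemma extremal_sols_scale_le:
  assumes u: "u \<in> U" and v: "v \<in> U" and r: "r \<in> {0<..1}"
    and le: "fclass_le Y (fclass_scale Y r u) v"
  shows "AE x in X. r * rep (min_sol X S \<Phi> u) x \<le> rep (min_sol X S \<Phi> v) x"
    and "AE x in X. r * rep (max_sol X S \<Phi> u) x \<le> rep (max_sol X S \<Phi> v) x"
proof -
  have r0: "0 < r" using r by auto
  let ?m = "min_sol X S \<Phi> v"
  define y where "y = fclass_scale X (1/r) ?m"
  have m: "?m \<in> Lq_plus X 2" "S (\<Phi> ?m) v = ?m" "?m \<in> L0 X"
    using min_sol(1)[OF v] sols_Lq_plus[OF v] by (auto simp: sols_def Lq_L0)
  have y: "y \<in> Lq_plus X 2" unfolding y_def using Lq_plus_scale[OF m(1), of "1/r"] r0 by simp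
  then have yL: "y \<in> Lq X 2" "y \<in> L0 X" by (auto simp: Lq_plus_def Lq_L0)
  have yrep: "AE x in X. rep y x = rep ?m x / r"
    using rep_fclass_scale(2)[OF m(3), of "1/r"] by (simp add: y_def)
  \<comment> \<open>Scaling back recovers the class \<open>m v\<close> itself, so that \<open>\<Phi>\<close> takes the same value on both.\<close>
  have "fclass_scale X r y = ?m"
  proof (rule fclass_le_antisym)
    have "AE x in X. rep (fclass_scale X r y) x = rep ?m x"
      using rep_fclass_scale(2)[OF yL(2), of r] yrep by eventually_elim (use r0 in auto)
    then show "fclass_le X (fclass_scale X r y) ?m" "fclass_le X ?m (fclass_scale X r y)"
      unfolding fclass_le_def by (auto elim: eventually_mono)
  qed (use rep_fclass_scale(1)[OF yL(2)] m(3) in auto)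
  then have scaled: "fclass_le X (fclass_scale X r (S (\<Phi> y) u)) ?m"
    using scaled_solution_operator_le[OF y u v r le] m(2) by simp
  have SL: "S (\<Phi> y) u \<in> L0 X" using S_range[OF u, of "\<Phi> y"] by (auto simp: Lq_plus_def Lq_L0)
  have "fclass_le X (S (\<Phi> y) u) y"
    using scaled unfolding fclass_le_def using yrep rep_fclass_scale(2)[OF SL, of r]
    by eventually_elim (use r0 in \<open>auto simp: pos_le_divide_eq mult.commute\<close>)
  then have "fclass_le X (min_sol X S \<Phi> u) y" using min_sol(2)[OF u yL(1)] by blast
  then show "AE x in X. r * rep (min_sol X S \<Phi> u) x \<le> rep ?m x"
    unfolding fclass_le_def using yrep by eventually_elim (use r0 in \<open>auto simp: field_simps\<close>)
next
  let ?M = "max_sol X S \<Phi> u"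
  have M: "?M \<in> Lq_plus X 2" "S (\<Phi> ?M) u = ?M" "?M \<in> L0 X"
    using max_sol(1)[OF u] sols_Lq_plus[OF u] by (auto simp: sols_def Lq_L0)
  have "fclass_scale X r ?M \<in> Lq X 2"
    using Lq_plus_scale[OF M(1), of r] r by (simp add: Lq_plus_def)
  moreover have "fclass_le X (fclass_scale X r ?M) (S (\<Phi> (fclass_scale X r ?M)) v)"
    using scaled_solution_operator_le[OF M(1) u v r le] M(2) by simp
  ultimately have "fclass_le X (fclass_scale X r ?M) (max_sol X S \<Phi> v)"
    using max_sol(2)[OF v] by blast
  then show "AE x in X. r * rep ?M x \<le> rep (max_sol X S \<Phi> v) x"
    unfolding fclass_le_def using rep_fclass_scale(2)[OF M(3), of r] by eventually_elim auto
qed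

end

section \<open>From two-sided scaling to norms\<close>

text \<open>Membership in \<open>L\<^sup>\<infinity>\<close> matters: the norm is a real number obtained from an extended one, and an
  infinite essential supremum would be turned into \<open>0\<close>.\<close>

lemma AE_le_Linf_norm_diff:
  assumes u: "u \<in> Lq M \<infinity>" and v: "v \<in> Lq M \<infinity>"
  shows "AE x in M. \<bar>rep u x - rep v x\<bar> \<le> Lq_norm M \<infinity> (fclass_diff M u v)"
proof -
  let ?eu = "esssup M (\<lambda>x. ennreal \<bar>rep u x\<bar>)" and ?ev = "esssup M (\<lambda>x. ennreal \<bar>rep v x\<bar>)"
  let ?f = "\<lambda>x. \<bar>rep (fclass_diff M u v) x\<bar>"
  note d = rep_fclass_diff[OF Lq_L0[OF u] Lq_L0[OF v]]
  have fin: "?eu < \<infinity>" "?ev < \<infinity>" using u v by (auto simp: Lq_def fun_in_Lq_def)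
  have [measurable]: "rep (fclass_diff M u v) \<in> borel_measurable M" using d(1) by (rule cls_rep(1))
  have "AE x in M. ennreal (?f x) \<le> ?eu + ?ev"
    using d(2) esssup_AE[of "\<lambda>x. ennreal \<bar>rep u x\<bar>" M] esssup_AE[of "\<lambda>x. ennreal \<bar>rep v x\<bar>" M]
  proof eventually_elim
    case (elim x)
    have "ennreal (?f x) \<le> ennreal (\<bar>rep u x\<bar> + \<bar>rep v x\<bar>)" using elim(1) by (intro ennreal_leI) auto
    also have "\<dots> = ennreal \<bar>rep u x\<bar> + ennreal \<bar>rep v x\<bar>" by simp
    also have "\<dots> \<le> ?eu + ?ev" using elim by (intro add_mono) auto
    finally show ?case .
  qed
  then have "esssup M (\<lambda>x. ennreal (?f x)) \<le> ?eu + ?ev" by (intro esssup_I) auto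
  then have "esssup M (\<lambda>x. ennreal (?f x)) < \<infinity>" using fin by (simp add: order.strict_trans1)
  then have e: "esssup M (\<lambda>x. ennreal (?f x)) = ennreal (Lq_norm M \<infinity> (fclass_diff M u v))"
    by (simp add: Lq_norm_def fun_Lq_norm_def)
  have n: "0 \<le> Lq_norm M \<infinity> (fclass_diff M u v)" by (simp add: Lq_norm_def fun_Lq_norm_def)
  show ?thesis
    using d(2) esssup_AE[of "\<lambda>x. ennreal (?f x)" M, unfolded e]
    by eventually_elim (use n in auto)
qed

lemma Lq_norm_diff_le_of_scaling:
  assumes a: "a \<in> Lq M q" and b: "b \<in> L0 M" and q: "1 \<le> q" and k: "0 \<le> k"
    and pos: "AE x in M. 0 \<le> rep a x"
    and lower: "AE x in M. (1 - k) * rep a x \<le> rep b x"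
    and upper: "AE x in M. 1 / (1 + k) * rep b x \<le> rep a x"
  shows "Lq_norm M q (fclass_diff M a b) \<le> k * Lq_norm M q a"
proof -
  note d = rep_fclass_diff[OF Lq_L0[OF a] b]
  have "AE x in M. \<bar>rep (fclass_diff M a b) x\<bar> \<le> k * \<bar>rep a x\<bar>"
    using d(2) pos lower upper by eventually_elim (use k in \<open>auto simp: field_simps abs_le_iff\<close>)
  then show ?thesis using Lq_dominated(2)[OF d(1) a _ k q] by blast
qed

theorem theorem3p2:
  fixes X :: "'x measure" and Y :: "'y measure"
    and \<iota> :: "'p::order_top \<Rightarrow> 'v::real_vector"
    and U :: "'y fclass set"
    and S :: "'p \<Rightarrow> 'y fclass \<Rightarrow> 'x fclass"
    and \<Phi> :: "'x fclass \<Rightarrow> 'p"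
    and q :: ennreal
  assumes X: "complete_measure X"
    and two_elements: "\<exists>p::'p. p \<noteq> top"
    and U_nonempty: "U \<noteq> {}"
    and S_range: "\<And>p u. u \<in> U \<Longrightarrow> S p u \<in> Lq_plus X 2"
    and S_mono: "\<And>p1 p2 u. u \<in> U \<Longrightarrow> p1 \<le> p2 \<Longrightarrow> fclass_le X (S p1 u) (S p2 u)"
    and \<Phi>_range: "\<And>v. v \<in> Lq X 2 \<Longrightarrow> \<Phi> v \<in> - {top}"
    and \<Phi>_mono: "\<And>v1 v2. v1 \<in> Lq X 2 \<Longrightarrow> v2 \<in> Lq X 2 \<Longrightarrow> fclass_le X v1 v2 \<Longrightarrow> \<Phi> v1 \<le> \<Phi> v2"
    and P_embedding: "inj_on \<iota> (- {top})"
    and P_scale: "\<And>p r. p \<in> - {top} \<Longrightarrow> r \<in> {0<..1} \<Longrightarrow> r *\<^sub>R \<iota> p \<in> \<iota> ` (- {top})"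
    and Y: "complete_measure Y"
    and U_subset: "U \<subseteq> Lq_plus Y \<infinity>"
    and U_scale: "\<And>u r. u \<in> U \<Longrightarrow> r \<in> {0<..1} \<Longrightarrow> fclass_scale Y r u \<in> U"
    and S_scale: "\<And>p u r. p \<in> - {top} \<Longrightarrow> u \<in> U \<Longrightarrow> r \<in> {0<..1} \<Longrightarrow>
        fclass_le X (fclass_scale X r (S p u)) (S (pscale \<iota> r p) (fclass_scale Y r u))"
    and S_mono_U: "\<And>p u1 u2. p \<in> - {top} \<Longrightarrow> u1 \<in> U \<Longrightarrow> u2 \<in> U \<Longrightarrow> fclass_le Y u1 u2 \<Longrightarrow>
        fclass_le X (S p u1) (S p u2)"
    and \<Phi>_scale: "\<And>v r. v \<in> Lq_plus X 2 \<Longrightarrow> r \<in> {0<..1} \<Longrightarrow>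
        pscale \<iota> r (\<Phi> v) \<le> \<Phi> (fclass_scale X r v)"
    and q: "1 \<le> q"
    and S_Lq: "\<And>p u. p \<in> - {top} \<Longrightarrow> u \<in> U \<Longrightarrow> S p u \<in> Lq X q"
  shows "\<forall>u\<in>U. \<forall>v\<in>U. \<forall>c \<rho> :: real.
      0 < c \<longrightarrow> (AE y in Y. c \<le> rep u y) \<longrightarrow>
      0 < \<rho> \<longrightarrow> \<rho> < c \<longrightarrow> Lq_norm Y \<infinity> (fclass_diff Y u v) \<le> c - \<rho> \<longrightarrow>
      Lq_norm X q (fclass_diff X (min_sol X S \<Phi> u) (min_sol X S \<Phi> v))
        \<le> 1 / \<rho> * Lq_norm X q (min_sol X S \<Phi> u) * Lq_norm Y \<infinity> (fclass_diff Y u v) \<and>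
      Lq_norm X q (fclass_diff X (max_sol X S \<Phi> u) (max_sol X S \<Phi> v))
        \<le> 1 / \<rho> * Lq_norm X q (max_sol X S \<Phi> u) * Lq_norm Y \<infinity> (fclass_diff Y u v)"
proof (intro ballI allI impI)
  fix u v and c \<rho> :: real
  assume u: "u \<in> U" and v: "v \<in> U" and c: "0 < c" and uc: "AE y in Y. c \<le> rep u y"
    and \<rho>: "0 < \<rho>" "\<rho> < c" and close: "Lq_norm Y \<infinity> (fclass_diff Y u v) \<le> c - \<rho>"
  interpret subhomogeneous_problem X S \<Phi> U Y \<iota>
    by unfold_locales (fact S_range S_mono \<Phi>_mono \<Phi>_range U_scale S_scale S_mono_U \<Phi>_scale)+
  define \<delta> where "\<delta> = Lq_norm Y \<infinity> (fclass_diff Y u v)"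
  define k where "k = \<delta> / c"
  have \<delta>: "0 \<le> \<delta>" "\<delta> \<le> c - \<rho>" using close by (auto simp: \<delta>_def Lq_norm_def fun_Lq_norm_def)
  have k: "0 \<le> k" "k < 1" "\<delta> = k * c" using \<delta> c \<rho> by (auto simp: k_def field_simps)
  have r: "1 - k \<in> {0<..1}" "1 / (1 + k) \<in> {0<..1}" using k by (auto simp: field_simps)
  have uv: "u \<in> Lq Y \<infinity>" "v \<in> Lq Y \<infinity>" using u v U_subset by (auto simp: Lq_plus_def)
  have dist: "AE y in Y. \<bar>rep u y - rep v y\<bar> \<le> k * rep u y"
    using AE_le_Linf_norm_diff[OF uv, folded \<delta>_def] uc
  proof eventually_elim
    case (elim y)
    have "\<delta> \<le> k * rep u y" unfolding k(3) using elim k by (intro mult_left_mono) auto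
    with elim show ?case by simp
  qed
  have lower: "fclass_le Y (fclass_scale Y (1 - k) u) v"
    unfolding fclass_le_def using dist rep_fclass_scale(2)[OF Lq_L0[OF uv(1)], of "1 - k"]
    by eventually_elim (auto simp: algebra_simps abs_le_iff)
  have upper: "fclass_le Y (fclass_scale Y (1 / (1 + k)) v) u"
    unfolding fclass_le_def using dist rep_fclass_scale(2)[OF Lq_L0[OF uv(2)], of "1 / (1 + k)"]
  proof eventually_elim
    case (elim y)
    then have "rep v y \<le> (1 + k) * rep u y" by (simp add: algebra_simps abs_le_iff)
    then have "rep v y / (1 + k) \<le> rep u y" using k by (simp add: pos_divide_le_eq mult.commute)
    with elim show ?case by simp
  qed
  \<comment> \<open>The order comparison yields the factor \<open>k = \<delta> / c\<close>, which is at most \<open>\<delta> / \<rho>\<close> since \<open>\<rho> < c\<close>.\<close>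
  have kn: "k * Lq_norm X q a \<le> 1 / \<rho> * Lq_norm X q a * \<delta>" for a
  proof -
    have "0 \<le> Lq_norm X q a" by (simp add: Lq_norm_def fun_Lq_norm_def)
    moreover have "k \<le> \<delta> / \<rho>" using \<delta> \<rho> by (auto simp: k_def intro: divide_left_mono)
    ultimately have "k * Lq_norm X q a \<le> \<delta> / \<rho> * Lq_norm X q a" by (rule mult_right_mono[rotated])
    then show ?thesis by (simp add: mult_ac)
  qed
  have sol: "y \<in> Lq X q" "y \<in> Lq X 2" "AE x in X. 0 \<le> rep y x" if "w \<in> U" "y \<in> sols X S \<Phi> w" for y w
    using that S_Lq[of "\<Phi> y" w] \<Phi>_range[of y] sols_Lq_plus[of w y]
    by (auto simp: sols_def Lq_plus_iff)
  note l = extremal_sols_scale_le[OF u v r(1) lower] and h = extremal_sols_scale_le[OF v u r(2) upper]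
  note mu = sol[OF u min_sol(1)[OF u]] and mv = sol[OF v min_sol(1)[OF v]]
    and Mu = sol[OF u max_sol(1)[OF u]] and Mv = sol[OF v max_sol(1)[OF v]]
  show "Lq_norm X q (fclass_diff X (min_sol X S \<Phi> u) (min_sol X S \<Phi> v))
        \<le> 1 / \<rho> * Lq_norm X q (min_sol X S \<Phi> u) * Lq_norm Y \<infinity> (fclass_diff Y u v) \<and>
      Lq_norm X q (fclass_diff X (max_sol X S \<Phi> u) (max_sol X S \<Phi> v))
        \<le> 1 / \<rho> * Lq_norm X q (max_sol X S \<Phi> u) * Lq_norm Y \<infinity> (fclass_diff Y u v)"
    unfolding \<delta>_def[symmetric]
    using order_trans[OF Lq_norm_diff_le_of_scaling[OF mu(1) Lq_L0[OF mv(1)] q k(1) mu(3) l(1) h(1)] kn]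
      order_trans[OF Lq_norm_diff_le_of_scaling[OF Mu(1) Lq_L0[OF Mv(1)] q k(1) Mu(3) l(2) h(2)] kn]
    by blast
qed

end
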